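(* Let $n\ge1$, $I=\{0,\dots,n\}$, let $I^+\subset I$ be a nonempty proper subset and $I^0=I\setminus I^+$. Let $Z_I(\Lambda_0)=\sum_{\lambda\in\mathcal{P}}e^{-\underline{\mathrm{wt}}(\lambda)}$ be the generating function of all $(n+1)$-labeled partitions and $Z_{I^+}(\Lambda_0)=\sum_{\lambda\in\mathcal{P}_{I^+}}e^{-\underline{\mathrm{wt}}_{I^+}(\lambda)}$ the generating function of $I^+$-generated $(n+1)$-labeled partitions. Consider the substitution $$s_{I^0}:e^{\alpha_i}\mapsto\begin{cases}e^{\alpha_i}\exp\left(\frac{2\pi\sqrt{-1}}{r_i+2}+\frac{2\pi\sqrt{-1}}{l_i+2}\right),&i\in I^+,\\ \exp\left(\frac{2\pi\sqrt{-1}}{n_i+2}\right),&i\in I^0.\end{cases}$$ Then $$Z_{I^+}(\Lambda_0)=c_{I^0}^{-1}\,s_{I^0}(Z_I(\Lambda_0)),$$ where, with $m$ the minimum of $I^+$ in $\{0,\dots,n\}$, $c_{I^0}$ is the complex root of unity $$c_{I^0}=(-1)^m\exp\left(2\pi\sqrt{-1}\,\frac{m(m+1)}{2(l_m+2)}\right).$$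
   Context: $\mathbb{N}$ contains $0$. Label the block $(i,j)\in\mathbb{N}\times\mathbb{N}$ by $(i-j)\bmod(n+1)\in I$. $\mathcal{P}$ is the set of all partitions (including the empty one); $\lambda=(\lambda_1\ge\dots\ge\lambda_k)$ is identified with its Young diagram, the subset of $\mathbb{N}\times\mathbb{N}$ consisting of the $\lambda_i$ lowest blocks in column $i-1$ (first coordinate $i-1$). $\mathrm{wt}_j(\lambda)$ is the number of blocks of $\lambda$ labelled $j$; $\underline{\mathrm{wt}}(\lambda)=(\mathrm{wt}_i(\lambda))_{i\in I}$, $\underline{\mathrm{wt}}_{I^+}(\lambda)=(\mathrm{wt}_i(\lambda))_{i\in I^+}$. A partition is $I^+$-generated if all its addable blocks (blocks of $\mathbb{N}\times\mathbb{N}$ not in $\lambda$ whose addition gives again a Young diagram) have label in $I^+$; $\mathcal{P}_{I^+}$ is the set of these. For a vector $u=(u_i)$, $e^{-u}=\prod_i(e^{\alpha_i})^{-u_i}$ in formal variables $e^{\alpha_i}$. The substitution is applied termwise. Let $\tilde I^+,\tilde I^0\subset\mathbb{Z}$ be the preimages of $I^+,I^0$ under reduction mod $n+1$. For $i\in\tilde I^+$, $r_i=\max\{j\in\mathbb{Z}: i\le j,\ \{i+1,\dots,j\}\subseteq\tilde I^0\}-i$ and $l_i=i-\min\{j\in\mathbb{Z}: j\le i,\ \{j,\dots,i-1\}\subseteq\tilde I^0\}$. For $i\in\tilde I^0$, $n_i$ is the length of the maximal sequence of consecutive integers in $\tilde I^0$ containing $i$. These numbers depend only on $i$ mod $n+1$,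 hence are defined on $I^+$ and $I^0$. *)

theory Defs
  imports Complex_Main
begin

text \<open>Partitions are weakly decreasing lists of positive parts; the part with index \<open>i\<close> of the
  list is the height of column \<open>i\<close> of the Young diagram.\<close>

definition partitions :: "nat list set" where
  "partitions = {p. sorted_wrt (\<ge>) p \<and> 0 \<notin> set p}"

definition young :: "nat list \<Rightarrow> (nat \<times> nat) set" where
  "young p = {(i, j). i < length p \<and> j < p ! i}"

definition label :: "nat \<Rightarrow> nat \<times> nat \<Rightarrow> nat" where
  "label n b = nat ((int (fst b) - int (snd b)) mod (int n + 1))"

text \<open>Exponent vectors are functions vanishing outside the index set in question, so \<open>wt n J\<close>
  is the vector of the numbers of blocks labelled \<open>j\<close>, for \<open>j\<close> in \<open>J\<close>.\<close>

definition restr :: "nat set \<Rightarrow> (nat \<Rightarrow> nat) \<Rightarrow> nat \<Rightarrow> nat" where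
  "restr J u = (\<lambda>j. if j \<in> J then u j else 0)"

definition wt :: "nat \<Rightarrow> nat set \<Rightarrow> nat list \<Rightarrow> nat \<Rightarrow> nat" where
  "wt n J p = restr J (\<lambda>j. card {b \<in> young p. label n b = j})"

definition addable :: "nat list \<Rightarrow> (nat \<times> nat) set" where
  "addable p = {b. b \<notin> young p \<and> (\<exists>q \<in> partitions. young q = insert b (young p))}"

definition generated_partitions :: "nat \<Rightarrow> nat set \<Rightarrow> nat list set" where
  "generated_partitions n Ip = {p \<in> partitions. \<forall>b \<in> addable p. label n b \<in> Ip}"

text \<open>A formal power series in the inverses of the variables \<open>e^alpha_i\<close> is given by its
  coefficients: its value at \<open>u\<close> is the coefficient of \<open>e^(-u)\<close>, the product of the
  \<open>(e^alpha_i)^(-u i)\<close>. Accordingly \<open>gen_series S w\<close> is the sum of \<open>e^(-w x)\<close>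
  over all \<open>x\<close> in \<open>S\<close>; the sets counted here are finite in both uses, see \<open>finite_weight_fibre\<close>.\<close>

type_synonym series = "(nat \<Rightarrow> nat) \<Rightarrow> complex"

definition gen_series :: "'a set \<Rightarrow> ('a \<Rightarrow> nat \<Rightarrow> nat) \<Rightarrow> series" where
  "gen_series S w = (\<lambda>u. of_nat (card {x \<in> S. w x = u}))"

definition Z_all :: "nat \<Rightarrow> series" where
  "Z_all n = gen_series partitions (wt n {0..n})"

definition Z_generated :: "nat \<Rightarrow> nat set \<Rightarrow> series" where
  "Z_generated n Ip = gen_series (generated_partitions n Ip) (wt n Ip)"

definition preimage_mod :: "nat \<Rightarrow> nat set \<Rightarrow> int set" where
  "preimage_mod n J = {k. nat (k mod (int n + 1)) \<in> J}"

abbreviation I0_lift :: "nat \<Rightarrow> nat set \<Rightarrow> int set" where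
  "I0_lift n Ip \<equiv> preimage_mod n ({0..n} - Ip)"

definition r_set :: "nat \<Rightarrow> nat set \<Rightarrow> int \<Rightarrow> int set" where
  "r_set n Ip i = {j. i \<le> j \<and> {i + 1..j} \<subseteq> I0_lift n Ip}"

definition r_num :: "nat \<Rightarrow> nat set \<Rightarrow> int \<Rightarrow> int" where
  "r_num n Ip i = Max (r_set n Ip i) - i"

definition l_set :: "nat \<Rightarrow> nat set \<Rightarrow> int \<Rightarrow> int set" where
  "l_set n Ip i = {j. j \<le> i \<and> {j..i - 1} \<subseteq> I0_lift n Ip}"

definition l_num :: "nat \<Rightarrow> nat set \<Rightarrow> int \<Rightarrow> int" where
  "l_num n Ip i = i - Min (l_set n Ip i)"

text \<open>The union of two runs through \<open>i\<close> is again one, so the maximal run is the longest one.\<close>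

definition runs :: "nat \<Rightarrow> nat set \<Rightarrow> int \<Rightarrow> int set set" where
  "runs n Ip i = {{a..b} | a b. a \<le> i \<and> i \<le> b \<and> {a..b} \<subseteq> I0_lift n Ip}"

definition n_num :: "nat \<Rightarrow> nat set \<Rightarrow> int \<Rightarrow> nat" where
  "n_num n Ip i = Max (card ` runs n Ip i)"

text \<open>The substitution sending \<open>e^alpha_i\<close> to \<open>z i * e^alpha_i\<close> for \<open>i \<in> Ip\<close> and to the
  scalar \<open>z i\<close> for the other indices \<open>i\<close> in \<open>{0..n}\<close>, applied termwise: the term \<open>e^(-u)\<close> becomes
  \<open>(\<Prod>i\<in>{0..n}. z i powi - u i)\<close> times the monomial with exponent vector \<open>restr Ip u\<close>. For
  \<open>F = Z_all n\<close> only finitely many terms contribute to each monomial, see \<open>finite_subst_support\<close>.\<close>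

definition subst_series :: "nat \<Rightarrow> nat set \<Rightarrow> (nat \<Rightarrow> complex) \<Rightarrow> series \<Rightarrow> series" where
  "subst_series n Ip z F =
    (\<lambda>v. \<Sum>u | F u \<noteq> 0 \<and> restr Ip u = v. F u * (\<Prod>i\<in>{0..n}. z i powi (- int (u i))))"

definition s_scalar :: "nat \<Rightarrow> nat set \<Rightarrow> nat \<Rightarrow> complex" where
  "s_scalar n Ip i =
    (if i \<in> Ip
     then exp (2 * of_real pi * \<i> / of_int (r_num n Ip (int i) + 2)
             + 2 * of_real pi * \<i> / of_int (l_num n Ip (int i) + 2))
     else exp (2 * of_real pi * \<i> / of_nat (n_num n Ip (int i) + 2)))"

definition c_root :: "nat \<Rightarrow> nat set \<Rightarrow> complex" where
  "c_root n Ip = (let m = Min Ip in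
    (- 1) ^ m * exp (2 * of_real pi * \<i> *
      (of_nat (m * (m + 1)) / of_int (2 * (l_num n Ip (int m) + 2)))))"


text \<open>The sets whose maximum, minimum, cardinality or sum is taken above are finite (and, where
  needed, nonempty).\<close>

lemma lift_gap:
  assumes "Ip \<noteq> {}" "Ip \<subseteq> {0..n}" "{a..b} \<subseteq> I0_lift n Ip"
  shows "b < a + int n"
proof (rule ccontr)
  assume h: "\<not> b < a + int n"
  from assms obtain k where k: "k \<in> Ip" "k \<le> n" by fastforce
  define t where "t = a + (int k - a) mod (int n + 1)"
  have pos: "(int k - a) mod (int n + 1) \<ge> 0" "(int k - a) mod (int n + 1) < int n + 1"
    by (rule pos_mod_sign, simp) (rule pos_mod_bound, simp)
  have "t \<in> {a..b}" unfolding t_def using pos h by auto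
  then have "t \<in> I0_lift n Ip" using assms by auto
  moreover have "t mod (int n + 1) = int k"
    using k(2) unfolding t_def by (simp add: mod_simps)
  ultimately show False using k by (simp add: preimage_mod_def)
qed

lemma r_set_finite:
  assumes "Ip \<noteq> {}" "Ip \<subseteq> {0..n}"
  shows "finite (r_set n Ip i)" "i \<in> r_set n Ip i"
proof -
  have "r_set n Ip i \<subseteq> {i..i + 1 + int n}"
    using lift_gap[OF assms] unfolding r_set_def by force
  then show "finite (r_set n Ip i)" by (rule finite_subset) simp
  show "i \<in> r_set n Ip i" by (simp add: r_set_def)
qed

lemma l_set_finite:
  assumes "Ip \<noteq> {}" "Ip \<subseteq> {0..n}"
  shows "finite (l_set n Ip i)" "i \<in> l_set n Ip i"
proof -
  have "l_set n Ip i \<subseteq> {i - 1 - int n..i}"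
    using lift_gap[OF assms] unfolding l_set_def by force
  then show "finite (l_set n Ip i)" by (rule finite_subset) simp
  show "i \<in> l_set n Ip i" by (simp add: l_set_def)
qed

lemma runs_finite:
  assumes "Ip \<noteq> {}" "Ip \<subseteq> {0..n}"
  shows "finite (runs n Ip i)" "i \<in> I0_lift n Ip \<Longrightarrow> {i..i} \<in> runs n Ip i"
proof -
  have "runs n Ip i \<subseteq> Pow {i - int n..i + int n}"
  proof
    fix s assume "s \<in> runs n Ip i"
    then obtain a b where s: "s = {a..b}" "a \<le> i" "i \<le> b" "{a..b} \<subseteq> I0_lift n Ip"
      unfolding runs_def by blast
    then show "s \<in> Pow {i - int n..i + int n}"
      using lift_gap[OF assms s(4)] by auto
  qed
  then show "finite (runs n Ip i)" by (rule finite_subset) simp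
  show "{i..i} \<in> runs n Ip i" if "i \<in> I0_lift n Ip"
    using that unfolding runs_def by force
qed

lemma finite_young: "finite (young p)"
proof (rule finite_subset)
  show "young p \<subseteq> Sigma {..<length p} (\<lambda>i. {..<p ! i})"
    by (auto simp: young_def)
qed simp

lemma young_bound:
  assumes p: "p \<in> partitions" and j: "j \<in> J" "j \<le> n"
  shows "length p \<le> (n + 1) * (wt n J p j + 1)"
    and "set p \<subseteq> {..(n + 1) * (wt n J p j + 1)}"
proof -
  define N where "N = card {b \<in> young p. label n b = j}"
  have wt: "wt n J p j = N" using j by (simp add: wt_def restr_def N_def)
  have key: False
    if inj: "inj_on f {..N}" and sub: "f ` {..N} \<subseteq> {b \<in> young p. label n b = j}"
    for f :: "nat \<Rightarrow> nat \<times> nat"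
  proof -
    have "card (f ` {..N}) \<le> N"
      unfolding N_def using finite_young[of p] sub by (intro card_mono) (auto simp: N_def)
    then show False using card_image[OF inj] by simp
  qed
  have posp: "p ! i > 0" if "i < length p" for i
    using p that unfolding partitions_def by (metis (mono_tags, lifting) mem_Collect_eq neq0_conv nth_mem)
  have lmod: "nat (int j mod (int n + 1)) = j" using j by simp
  show "length p \<le> (n + 1) * (wt n J p j + 1)"
  proof (rule ccontr)
    assume h: "\<not> ?thesis"
    define f where "f q = ((n + 1) * q + j, 0::nat)" for q
    have "f q \<in> {b \<in> young p. label n b = j}" if "q \<le> N" for q
    proof -
      have "(n + 1) * q \<le> (n + 1) * N" using that by (intro mult_le_mono2)
      then have "(n + 1) * q + j < length p" using h j wt by simp
      moreover have "int ((n + 1) * q + j) mod (int n + 1) = int j"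
      proof -
        have "int ((n + 1) * q + j) = int j + int q * (int n + 1)" by (simp add: algebra_simps)
        then show ?thesis using j by simp
      qed
      ultimately show ?thesis using posp by (simp add: f_def young_def label_def)
    qed
    moreover have "inj_on f {..N}"
    proof (rule inj_onI)
      fix x y assume "f x = f y"
      then have "(n + 1) * x = (n + 1) * y" by (simp add: f_def)
      then show "x = y" by (simp only: mult_cancel1) simp
    qed
    ultimately show False using key[of f] by auto
  qed
  show "set p \<subseteq> {..(n + 1) * (wt n J p j + 1)}"
  proof (rule ccontr)
    assume h: "\<not> ?thesis"
    then obtain i where i: "i < length p" "p ! i > (n + 1) * (N + 1)"
      unfolding wt by (metis atMost_iff in_set_conv_nth not_le subsetI)
    have "p ! 0 \<ge> p ! i"
      using p i by (cases "i = 0") (auto simp: partitions_def sorted_wrt_iff_nth_less)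
    then have p0: "p ! 0 > (n + 1) * (N + 1)" "0 < length p" using i by auto
    define f where "f q = (0::nat, (n + 1) * (q + 1) - j)" for q
    have "f q \<in> {b \<in> young p. label n b = j}" if "q \<le> N" for q
    proof -
      have "(n + 1) * (q + 1) \<le> (n + 1) * (N + 1)" using that by (intro mult_le_mono2) simp
      then have "(n + 1) * (q + 1) - j < p ! 0" using p0 by linarith
      moreover have "(- int ((n + 1) * (q + 1) - j)) mod (int n + 1) = int j"
      proof -
        have "j \<le> (n + 1) * (q + 1)" using j by simp
        then have "- int ((n + 1) * (q + 1) - j) = int j + (- int q - 1) * (int n + 1)"
          by (simp add: of_nat_diff algebra_simps)
        then show ?thesis using j by (simp del: of_nat_diff)
      qed
      ultimately show ?thesis using p0 by (simp add: f_def young_def label_def)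
    qed
    moreover have "inj_on f {..N}"
    proof (rule inj_onI)
      fix x y assume "f x = f y"
      then have "(n + 1) * (x + 1) - j = (n + 1) * (y + 1) - j" by (simp add: f_def)
      moreover have "j \<le> (n + 1) * (x + 1)" "j \<le> (n + 1) * (y + 1)" using j by auto
      ultimately have "(n + 1) * (x + 1) = (n + 1) * (y + 1)" by linarith
      then show "x = y" by (simp only: mult_cancel1) simp
    qed
    ultimately show False using key[of f] by auto
  qed
qed

lemma finite_weight_fibre:
  assumes "J \<noteq> {}" "J \<subseteq> {0..n}"
  shows "finite {p \<in> partitions. wt n J p = u}"
proof -
  from assms obtain j where j: "j \<in> J" "j \<le> n" by fastforce
  let ?B = "(n + 1) * (u j + 1)"
  have "{p \<in> partitions. wt n J p = u} \<subseteq> {p. set p \<subseteq> {..?B} \<and> length p \<le> ?B}"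
    using young_bound[OF _ j] by blast
  then show ?thesis by (rule finite_subset) (rule finite_lists_length_le, simp)
qed

lemma finite_subst_support:
  assumes "Ip \<noteq> {}" "Ip \<subseteq> {0..n}"
  shows "finite {u. Z_all n u \<noteq> 0 \<and> restr Ip u = v}"
proof (rule finite_subset)
  show "{u. Z_all n u \<noteq> 0 \<and> restr Ip u = v}
      \<subseteq> wt n {0..n} ` {p \<in> partitions. wt n Ip p = v}"
  proof
    fix u assume u: "u \<in> {u. Z_all n u \<noteq> 0 \<and> restr Ip u = v}"
    then have "{p \<in> partitions. wt n {0..n} p = u} \<noteq> {}"
      by (auto simp: Z_all_def gen_series_def simp del: Collect_empty_eq)
    then obtain p where p: "p \<in> partitions" "wt n {0..n} p = u" by auto
    have "wt n Ip p = restr Ip u"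
      using p(2) assms(2) by (fastforce simp: wt_def restr_def fun_eq_iff)
    then show "u \<in> wt n {0..n} ` {p \<in> partitions. wt n Ip p = v}" using u p by auto
  qed
qed (use finite_weight_fibre[OF assms] in simp)

end

theory Submission
  imports Defs
begin

text \<open>Let \<open>P\<close> be the set of integers whose residue lies in \<open>Ip\<close>, and call a block coloured if its
  content (first minus second coordinate) lies in \<open>P\<close>. Sort all partitions by their sets of
  coloured blocks. Each class contains exactly one \<open>Ip\<close>-generated partition, its largest member
  (\<open>generated_partition_exists\<close>, \<open>generated_partition_unique\<close>), and the exponents of the
  variables that survive the substitution are constant on the class. So the theorem follows
  once, over each class, the sum of the scalars produced by the substitution is \<open>c_root n Ip\<close>.

  Encode a partition by the set \<open>X\<close> of contents at which the first \<open>L\<close> horizontal steps of its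
  boundary path start. The scalar of a block of content \<open>c\<close> is a ratio \<open>W (c - 1) / W c\<close>, where
  \<open>W = edge_weight P\<close> (\<open>s_scalar_edge_weight\<close>). Hence the product over each column telescopes, and
  the scalar of the partition is the product of \<open>W\<close> over \<open>X\<close>, divided by the product of \<open>W\<close> over
  \<open>0, \<dots>, L - 1\<close> (\<open>prod_content_eq_prod_steps\<close>). Between neighbouring members \<open>a < b\<close> of \<open>P\<close>, the
  values of \<open>W\<close> on \<open>a, \<dots>, b - 1\<close> are \<open>q ^ (b - a), \<dots>, q ^ 1\<close> for a primitive root of unity \<open>q\<close> of
  order \<open>b - a + 1\<close>.

  Fixing the coloured blocks amounts to fixing the number of elements of \<open>X\<close> in each gap
  \<open>{a..<b}\<close> (\<open>card_steps_below_eq_iff\<close>). The sum over the class is therefore a product of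
  elementary symmetric functions of \<open>q, \<dots>, q ^ (N - 1)\<close> with \<open>q\<close> primitive of order \<open>N\<close>, and the
  \<open>j\<close>-th of these is \<open>(- 1) ^ j\<close> (\<open>elementary_symmetric_root_of_unity\<close>): all the signs together
  give \<open>(- 1) ^ L\<close>, whatever the class. In the denominator, each full gap contributes a sign as
  well, and only the initial piece of the gap containing \<open>0\<close>, that is \<open>0, \<dots>, m - 1\<close> with
  \<open>m = Min Ip\<close>, leaves a root of unity. That is \<open>c_root n Ip\<close>
  (\<open>sum_over_fibre\<close>, \<open>c_root_eq_prod_edge_weight\<close>).\<close>

section \<open>Elementary symmetric functions of the powers of a root of unity\<close>

text \<open>Rotating \<open>{..<N}\<close> by one step permutes its \<open>j\<close>-element subsets and multiplies each
  summand by \<open>q ^ j\<close>, so the sum equals \<open>q ^ j\<close> times itself.\<close>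

lemma sum_over_subsets_root_of_unity_eq_0:
  fixes q :: "'a :: idom"
  assumes "q ^ N = 1" "q ^ j \<noteq> 1"
  shows "(\<Sum>Y | Y \<subseteq> {..<N} \<and> card Y = j. \<Prod>x\<in>Y. q ^ x) = 0"
proof -
  define E where "E = (\<Sum>Y | Y \<subseteq> {..<N} \<and> card Y = j. \<Prod>x\<in>Y. q ^ x)"
  define s where "s x = (if Suc x = N then 0 else Suc x)" for x
  define t where "t x = (if x = 0 then N - 1 else x - 1)" for x
  have ts: "t (s x) = x" and s: "s x < N" if "x < N" for x
    using that by (auto simp: s_def t_def)
  have st: "s (t x) = x" and t: "t x < N" if "x < N" for x
    using that by (auto simp: s_def t_def)
  have inj_s: "inj_on s Y" and inj_t: "inj_on t Y" if "Y \<subseteq> {..<N}" for Y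
    using that ts st by (metis inj_on_inverseI lessThan_iff subsetD)+
  have "E = (\<Sum>Y | Y \<subseteq> {..<N} \<and> card Y = j. q ^ j * (\<Prod>x\<in>Y. q ^ x))"
    unfolding E_def
  proof (rule sum.reindex_bij_witness[of _ "\<lambda>Y. s ` Y" "\<lambda>Y. t ` Y"])
    fix Y assume Y: "Y \<in> {Y. Y \<subseteq> {..<N} \<and> card Y = j}"
    then show "s ` t ` Y = Y" "t ` s ` Y = Y"
      using st ts by (force simp: image_image)+
    show "t ` Y \<in> {Y. Y \<subseteq> {..<N} \<and> card Y = j}" "s ` Y \<in> {Y. Y \<subseteq> {..<N} \<and> card Y = j}"
      using Y t s inj_s inj_t by (auto simp: card_image)
    have step: "q * q ^ t x = q ^ x" if "x \<in> Y" for x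
      using that Y assms(1) by (cases N) (auto simp: t_def simp flip: power_Suc)
    have "q ^ j * (\<Prod>x\<in>t ` Y. q ^ x) = (\<Prod>x\<in>Y. q * q ^ t x)"
      using Y inj_t by (simp add: prod.reindex prod.distrib)
    also have "\<dots> = (\<Prod>x\<in>Y. q ^ x)"
      using step by (rule prod.cong[OF refl])
    finally show "q ^ j * (\<Prod>x\<in>t ` Y. q ^ x) = (\<Prod>x\<in>Y. q ^ x)" .
  qed
  then have "E = q ^ j * E"
    unfolding E_def sum_distrib_left .
  then have "(q ^ j - 1) * E = 0"
    by (simp add: algebra_simps)
  then show ?thesis
    using assms(2) by (simp add: E_def)
qed

text \<open>The sum over the subsets of \<open>{..<N}\<close> is the sum over those avoiding \<open>0\<close> plus the sum over
  those containing \<open>0\<close>. As it vanishes, raising \<open>j\<close> by one changes the sign of the sum over the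
  subsets of \<open>{1..<N}\<close>.\<close>

lemma elementary_symmetric_root_of_unity:
  fixes q :: "'a :: idom"
  assumes "q ^ N = 1" "\<And>i. 0 < i \<Longrightarrow> i < N \<Longrightarrow> q ^ i \<noteq> 1" "j < N"
  shows "(\<Sum>Y | Y \<subseteq> {1..<N} \<and> card Y = j. \<Prod>x\<in>Y. q ^ x) = (- 1) ^ j"
  using \<open>j < N\<close>
proof (induction j)
  case 0
  have "{Y. Y \<subseteq> {1..<N} \<and> card Y = 0} = {{}}"
    by (auto dest: finite_subset)
  then show ?case by simp
next
  case (Suc j)
  let ?A = "{Y. Y \<subseteq> {1..<N} \<and> card Y = Suc j}" and ?B = "{Y. Y \<subseteq> {1..<N} \<and> card Y = j}"
  have fin: "finite Y" if "Y \<subseteq> {1..<N}" for Y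
    using that finite_subset by blast
  have zero: "0 \<notin> Y" if "Y \<subseteq> {1..<N}" for Y
    using that by auto
  have "{Y. Y \<subseteq> {..<N} \<and> card Y = Suc j} = ?A \<union> insert 0 ` ?B"
  proof (intro equalityI subsetI)
    fix Y assume Y: "Y \<in> {Y. Y \<subseteq> {..<N} \<and> card Y = Suc j}"
    then have fY: "finite Y" using finite_subset by blast
    have sub: "Y - {0} \<subseteq> {1..<N}" using Y by (auto simp: Suc_le_eq)
    show "Y \<in> ?A \<union> insert 0 ` ?B"
    proof (cases "0 \<in> Y")
      case True
      then have "Y = insert 0 (Y - {0})" by auto
      moreover have "Y - {0} \<in> ?B" using Y sub fY True by simp
      ultimately show ?thesis by blast
    qed (use Y sub in auto)
  next
    fix Y assume "Y \<in> ?A \<union> insert 0 ` ?B"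
    then consider "Y \<in> ?A" | Z where "Z \<in> ?B" "Y = insert 0 Z" by blast
    then show "Y \<in> {Y. Y \<subseteq> {..<N} \<and> card Y = Suc j}"
    proof cases
      case 1
      then show ?thesis by (simp add: subset_eq)
    next
      case 2
      then show ?thesis using Suc.prems fin[of Z] zero[of Z] by (simp add: subset_eq)
    qed
  qed
  moreover have "finite ?A" "finite ?B" "?A \<inter> insert 0 ` ?B = {}"
    using zero by auto
  moreover have "inj_on (insert 0) ?B"
    using zero by (intro inj_onI) (metis (mono_tags, lifting) insert_ident mem_Collect_eq)
  ultimately have "(\<Sum>Y | Y \<subseteq> {..<N} \<and> card Y = Suc j. \<Prod>x\<in>Y. q ^ x)
      = (\<Sum>Y\<in>?A. \<Prod>x\<in>Y. q ^ x) + (\<Sum>Y\<in>?B. \<Prod>x\<in>insert 0 Y. q ^ x)"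
    by (simp add: sum.union_disjoint sum.reindex)
  also have "(\<Sum>Y\<in>?B. \<Prod>x\<in>insert 0 Y. q ^ x) = (\<Sum>Y\<in>?B. \<Prod>x\<in>Y. q ^ x)"
    using fin zero by (intro sum.cong) auto
  also have "\<dots> = (- 1) ^ j"
    using Suc by simp
  finally show ?case
    using sum_over_subsets_root_of_unity_eq_0[OF assms(1), of "Suc j"] assms(2)[of "Suc j"] Suc.prems
    by (simp add: eq_neg_iff_add_eq_0)
qed

definition unity_root :: "nat \<Rightarrow> complex" where
  "unity_root N = exp (2 * of_real pi * \<i> / of_nat N)"

lemma unity_root_cis: "unity_root N ^ j = cis (2 * pi * real j / real N)"
proof -
  have "unity_root N = cis (2 * pi / real N)"
    by (simp add: unity_root_def cis_conv_exp algebra_simps)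
  then show ?thesis
    by (simp add: Complex.DeMoivre algebra_simps)
qed

lemma unity_root_power: "N > 0 \<Longrightarrow> unity_root N ^ N = 1"
  by (simp add: unity_root_cis)

lemma unity_root_primitive:
  assumes "0 < i" "i < N"
  shows "unity_root N ^ i \<noteq> 1"
proof
  assume "unity_root N ^ i = 1"
  then have "cis (2 * pi * real i / real N) = cis (2 * pi * real 0 / real N)"
    by (simp add: unity_root_cis)
  then have "i = 0"
    using inj_onD[OF bij_betw_imp_inj_on[OF bij_betw_roots_unity[of N]], of i 0] assms by simp
  then show False using assms by simp
qed

lemma unity_root_nonzero [simp]: "unity_root N \<noteq> 0"
  by (simp add: unity_root_def)

section \<open>Gaps of an unbounded set of integers\<close>

text \<open>A gap stands for a maximal run of consecutive labels outside the given set; it is recorded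
  by the two members of the set that enclose it, so that empty runs need no special treatment.\<close>

definition gap :: "int set \<Rightarrow> int \<Rightarrow> int \<Rightarrow> bool" where
  "gap P a b \<longleftrightarrow> a \<in> P \<and> b \<in> P \<and> a < b \<and> {a<..<b} \<inter> P = {}"

definition unbounded_both :: "int set \<Rightarrow> bool" where
  "unbounded_both P \<longleftrightarrow> (\<forall>x. (\<exists>a\<in>P. a \<le> x) \<and> (\<exists>b\<in>P. x < b))"

definition gap_start :: "int set \<Rightarrow> int \<Rightarrow> int" where
  "gap_start P x = x - int (LEAST k. x - int k \<in> P)"

definition gap_end :: "int set \<Rightarrow> int \<Rightarrow> int" where
  "gap_end P x = x + 1 + int (LEAST k. x + 1 + int k \<in> P)"

lemma gap_around:
  assumes "unbounded_both P"
  shows "gap P (gap_start P x) (gap_end P x)" "gap_start P x \<le> x" "x < gap_end P x"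
proof -
  obtain a b where a: "a \<in> P" "a \<le> x" and b: "b \<in> P" "x < b"
    using assms unfolding unbounded_both_def by blast
  have ex: "\<exists>k. x - int k \<in> P" "\<exists>k. x + 1 + int k \<in> P"
    by (rule exI[of _ "nat (x - a)"], use a in simp) (rule exI[of _ "nat (b - x - 1)"], use b in simp)
  have mem: "gap_start P x \<in> P" "gap_end P x \<in> P"
    unfolding gap_start_def gap_end_def using LeastI_ex[OF ex(1)] LeastI_ex[OF ex(2)] by auto
  have "y \<notin> P" if y: "gap_start P x < y" "y < gap_end P x" for y
  proof (cases "y \<le> x")
    case True
    then have "nat (x - y) < (LEAST k. x - int k \<in> P)"
      using y unfolding gap_start_def by linarith
    from not_less_Least[OF this] True show ?thesis by simp
  next
    case False
    then have "nat (y - x - 1) < (LEAST k. x + 1 + int k \<in> P)"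
      using y unfolding gap_end_def by linarith
    from not_less_Least[OF this] False show ?thesis by simp
  qed
  moreover show "gap_start P x \<le> x" "x < gap_end P x"
    by (auto simp: gap_start_def gap_end_def)
  ultimately show "gap P (gap_start P x) (gap_end P x)"
    using mem unfolding gap_def by auto
qed

lemma gap_bounds_eq:
  assumes "gap P a b" "a \<le> x" "x < b"
  shows "gap_start P x = a" "gap_end P x = b"
proof -
  have "(LEAST k. x - int k \<in> P) = nat (x - a)"
    using assms unfolding gap_def by (intro Least_equality) (force simp: set_eq_iff not_less)+
  then show "gap_start P x = a" using assms by (simp add: gap_start_def)
  have "(LEAST k. x + 1 + int k \<in> P) = nat (b - x - 1)"
    using assms unfolding gap_def by (intro Least_equality) (force simp: set_eq_iff not_less)+
  then show "gap_end P x = b" using assms by (simp add: gap_end_def)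
qed

section \<open>Weighted sums over subsets with prescribed counts\<close>

text \<open>This weight turns the product over the blocks of a partition into a telescoping one: the
  scalar attached to a block of content \<open>c\<close> will be the ratio of the weights at \<open>c - 1\<close> and \<open>c\<close>.
  The condition determines the weight up to a constant; this choice of the constant makes the
  weight depend on the gap containing \<open>x\<close> only.\<close>

definition edge_weight :: "int set \<Rightarrow> int \<Rightarrow> complex" where
  "edge_weight P x = inverse (unity_root (nat (gap_end P x - gap_start P x + 1)))
     ^ nat (gap_end P x - x)"

lemma edge_weight_gap:
  assumes "gap P a b" "a \<le> x" "x < b"
  shows "edge_weight P x = inverse (unity_root (nat (b - a + 1))) ^ nat (b - x)"
  by (simp add: edge_weight_def gap_bounds_eq[OF assms])

lemma edge_weight_nonzero [simp]: "edge_weight P x \<noteq> 0"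
  by (simp add: edge_weight_def)

text \<open>Along a gap of length \<open>b - a\<close> the edge weights are the powers with exponents
  \<open>1, \<dots>, b - a\<close> of a primitive root of unity of order \<open>b - a + 1\<close>.\<close>

lemma sum_edge_weight_gap:
  assumes "gap P a b" "int j \<le> b - a"
  shows "(\<Sum>Y | Y \<subseteq> {a..<b} \<and> card Y = j. \<Prod>x\<in>Y. edge_weight P x) = (- 1) ^ j"
proof -
  define N where "N = nat (b - a + 1)"
  define q where "q = inverse (unity_root N)"
  have N: "0 < N" "j < N" "int N = b - a + 1"
    using assms by (auto simp: N_def gap_def)
  have "(\<Sum>Y | Y \<subseteq> {a..<b} \<and> card Y = j. \<Prod>x\<in>Y. edge_weight P x)
      = (\<Sum>Y | Y \<subseteq> {1..<N} \<and> card Y = j. \<Prod>x\<in>Y. q ^ x)"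
  proof (rule sum.reindex_bij_witness[of _ "\<lambda>Y. (\<lambda>x. b - int x) ` Y" "\<lambda>Y. (\<lambda>x. nat (b - x)) ` Y"])
    fix Y assume Y: "Y \<in> {Y. Y \<subseteq> {a..<b} \<and> card Y = j}"
    have inj: "inj_on (\<lambda>x. nat (b - x)) Y"
      using Y by (force intro: inj_onI)
    show "(\<lambda>x. b - int x) ` (\<lambda>x. nat (b - x)) ` Y = Y"
      using Y by (force simp: image_image image_iff)
    have "nat (b - x) \<in> {1..<N}" if "x \<in> Y" for x
      using that Y N by force
    then show "(\<lambda>x. nat (b - x)) ` Y \<in> {Y. Y \<subseteq> {1..<N} \<and> card Y = j}"
      using Y inj by (auto simp: card_image)
    have "edge_weight P x = q ^ nat (b - x)" if "x \<in> Y" for x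
      using that Y edge_weight_gap[OF assms(1)] by (force simp: q_def N_def)
    then show "(\<Prod>x\<in>(\<lambda>x. nat (b - x)) ` Y. q ^ x) = (\<Prod>x\<in>Y. edge_weight P x)"
      using inj by (simp add: prod.reindex)
  next
    fix Y assume Y: "Y \<in> {Y. Y \<subseteq> {1..<N} \<and> card Y = j}"
    show "(\<lambda>x. nat (b - x)) ` (\<lambda>x. b - int x) ` Y = Y"
      by (simp add: image_image)
    have "b - int x \<in> {a..<b}" if "x \<in> Y" for x
      using that Y N by force
    then show "(\<lambda>x. b - int x) ` Y \<in> {Y. Y \<subseteq> {a..<b} \<and> card Y = j}"
      using Y by (auto simp: card_image inj_on_def)
  qed
  also have "\<dots> = (- 1) ^ j"
    using N unity_root_power[of N] unity_root_primitive[of _ N]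
    by (intro elementary_symmetric_root_of_unity) (auto simp: q_def power_inverse)
  finally show ?thesis .
qed

text \<open>Prescribing the number of elements below each member of \<open>P\<close> prescribes it in each gap, so
  that the sum is a product over the gaps of the sums of the preceding lemma.\<close>

lemma sum_edge_weight_prescribed:
  assumes "unbounded_both P" "A \<in> P" "B \<in> P" "A \<le> B" "X0 \<subseteq> {A..<B}"
  shows "(\<Sum>X | X \<subseteq> {A..<B} \<and> (\<forall>c\<in>P \<inter> {A..B}. card (X \<inter> {..<c}) = card (X0 \<inter> {..<c})).
      \<Prod>x\<in>X. edge_weight P x) = (- 1) ^ card X0"
  using assms(3-5)
proof (induction "nat (B - A)" arbitrary: B X0 rule: less_induct)
  case less
  show ?case
  proof (cases "B = A")
    case True
    then have "{X. X \<subseteq> {A..<B} \<and> (\<forall>c\<in>P \<inter> {A..B}. card (X \<inter> {..<c}) = card (X0 \<inter> {..<c}))} = {{}}"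
      and "X0 = {}"
      using less.prems by auto
    then show ?thesis by simp
  next
    case False
    \<comment> \<open>Split off the last gap before \<open>B\<close>.\<close>
    define a where "a = gap_start P (B - 1)"
    have gap: "gap P a B"
    proof -
      note g = gap_around[OF assms(1), of "B - 1"]
      then have "gap_end P (B - 1) = B"
        using less.prems(1) unfolding gap_def by (fastforce simp: set_eq_iff not_less)
      then show ?thesis using g by (simp add: a_def)
    qed
    then have aP: "a \<in> P" and aB: "a < B" and none: "\<And>c. c \<in> P \<Longrightarrow> c \<le> a \<or> B \<le> c"
      by (auto simp: gap_def set_eq_iff not_less)
    then have Aa: "A \<le> a"
      using assms(2) less.prems False by fastforce
    define X1 where "X1 = X0 \<inter> {..<a}"
    define j where "j = card (X0 \<inter> {a..<B})"
    define F where "F = {X. X \<subseteq> {A..<a} \<and> (\<forall>c\<in>P \<inter> {A..a}. card (X \<inter> {..<c}) = card (X1 \<inter> {..<c}))}"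
    define G where "G = {Y. Y \<subseteq> {a..<B} \<and> card Y = j}"
    have finX: "finite X" if "X \<subseteq> {A..<B}" for X
      using that finite_subset by blast
    have split: "card X = card (X \<inter> {..<a}) + card (X \<inter> {a..<B})" if "X \<subseteq> {A..<B}" for X
    proof -
      have "X = X \<inter> {..<a} \<union> X \<inter> {a..<B}" using that by auto
      then show ?thesis
        using finX[OF that] by (metis card_Un_disjoint finite_Int Int_assoc Int_commute Int_empty_left
            ivl_disj_int_one(2) Int_left_commute)
    qed
    have cardX0: "card X0 = card X1 + j"
      using split[OF less.prems(3)] by (simp add: X1_def j_def)
    have "j \<le> card {a..<B}" unfolding j_def by (rule card_mono) auto
    then have j: "int j \<le> B - a" using aB by simp
    have "(\<Sum>X | X \<subseteq> {A..<B} \<and> (\<forall>c\<in>P \<inter> {A..B}. card (X \<inter> {..<c}) = card (X0 \<inter> {..<c})).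
        \<Prod>x\<in>X. edge_weight P x)
      = (\<Sum>(X, Y)\<in>F \<times> G. (\<Prod>x\<in>X. edge_weight P x) * (\<Prod>x\<in>Y. edge_weight P x))"
    proof (rule sum.reindex_bij_witness[of _ "\<lambda>(X, Y). X \<union> Y" "\<lambda>X. (X \<inter> {..<a}, X \<inter> {a..<B})"])
      fix X
      assume X: "X \<in> {X. X \<subseteq> {A..<B} \<and> (\<forall>c\<in>P \<inter> {A..B}. card (X \<inter> {..<c}) = card (X0 \<inter> {..<c}))}"
      show "(case (X \<inter> {..<a}, X \<inter> {a..<B}) of (X, Y) \<Rightarrow> X \<union> Y) = X"
        using X by auto
      have cut: "X \<inter> {..<a} \<inter> {..<c} = X \<inter> {..<c}" if "c \<le> a" for X c
        using that by auto
      have "X \<inter> {..<a} \<in> F"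
        using X Aa aB less.prems by (auto simp: F_def X1_def cut)
      moreover have "X \<inter> {a..<B} \<in> G"
      proof -
        have "X \<inter> {..<B} = X" "X0 \<inter> {..<B} = X0" using X less.prems(3) by auto
        then have "card X = card X0" "card (X \<inter> {..<a}) = card (X0 \<inter> {..<a})"
          using X less.prems Aa aP aB by (auto dest: bspec[of _ _ B] bspec[of _ _ a])
        then show ?thesis
          using split[of X] split[of X0] X less.prems(3) by (auto simp: G_def j_def)
      qed
      ultimately show "(X \<inter> {..<a}, X \<inter> {a..<B}) \<in> F \<times> G" by simp
      have "X = X \<inter> {..<a} \<union> X \<inter> {a..<B}" using X by auto
      then have "(\<Prod>x\<in>X. edge_weight P x)
          = (\<Prod>x\<in>X \<inter> {..<a}. edge_weight P x) * (\<Prod>x\<in>X \<inter> {a..<B}. edge_weight P x)"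
        using X finX[of X] by (subst prod.union_disjoint[symmetric]) auto
      then show "(case (X \<inter> {..<a}, X \<inter> {a..<B}) of (X, Y) \<Rightarrow>
          (\<Prod>x\<in>X. edge_weight P x) * (\<Prod>x\<in>Y. edge_weight P x)) = (\<Prod>x\<in>X. edge_weight P x)"
        by simp
    next
      fix XY assume "XY \<in> F \<times> G"
      then obtain X Y where XY: "XY = (X, Y)" "X \<in> F" "Y \<in> G" by auto
      then have sub: "X \<subseteq> {A..<a}" "Y \<subseteq> {a..<B}" by (auto simp: F_def G_def)
      then have low: "(X \<union> Y) \<inter> {..<a} = X" and high: "(X \<union> Y) \<inter> {a..<B} = Y" by auto
      show "((case XY of (X, Y) \<Rightarrow> X \<union> Y) \<inter> {..<a}, (case XY of (X, Y) \<Rightarrow> X \<union> Y) \<inter> {a..<B}) = XY"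
        using XY low high by simp
      have un: "X \<union> Y \<subseteq> {A..<B}" using sub Aa aB by auto
      have "card ((X \<union> Y) \<inter> {..<c}) = card (X0 \<inter> {..<c})" if c: "c \<in> P" "A \<le> c" "c \<le> B" for c
      proof (cases "c \<le> a")
        case True
        then have "(X \<union> Y) \<inter> {..<c} = X \<inter> {..<c}" "X0 \<inter> {..<c} = X1 \<inter> {..<c}"
          using sub by (auto simp: X1_def)
        then show ?thesis using XY(2) c True by (auto simp: F_def)
      next
        case False
        then have [simp]: "c = B" using none[OF c(1)] c by simp
        have "X \<inter> {..<a} = X" "X1 \<inter> {..<a} = X1" using sub by (auto simp: X1_def)
        then have "card X = card X1"
          using XY(2) Aa aP by (auto simp: F_def dest: bspec[of _ _ a])
        then have "card (X \<union> Y) = card X0"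
          using split[OF un] XY(3) low high cardX0 by (simp add: G_def)
        moreover have "(X \<union> Y) \<inter> {..<B} = X \<union> Y" "X0 \<inter> {..<B} = X0" using un less.prems(3) by auto
        ultimately show ?thesis by simp
      qed
      then show "(case XY of (X, Y) \<Rightarrow> X \<union> Y)
          \<in> {X. X \<subseteq> {A..<B} \<and> (\<forall>c\<in>P \<inter> {A..B}. card (X \<inter> {..<c}) = card (X0 \<inter> {..<c}))}"
        using XY un by simp
    qed
    also have "\<dots> = (\<Sum>X\<in>F. \<Prod>x\<in>X. edge_weight P x) * (\<Sum>Y\<in>G. \<Prod>x\<in>Y. edge_weight P x)"
      by (simp add: sum_product sum.cartesian_product)
    also have "(\<Sum>X\<in>F. \<Prod>x\<in>X. edge_weight P x) = (- 1) ^ card X1"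
      unfolding F_def using less.prems(3) aP Aa aB by (intro less.hyps) (auto simp: X1_def)
    also have "(\<Sum>Y\<in>G. \<Prod>x\<in>Y. edge_weight P x) = (- 1) ^ j"
      unfolding G_def by (rule sum_edge_weight_gap[OF gap j])
    finally show ?thesis by (simp add: cardX0 power_add)
  qed
qed

text \<open>This is the preceding sum for counts that leave the whole interval as the only choice.\<close>

lemma prod_edge_weight_between:
  assumes "unbounded_both P" "A \<in> P" "B \<in> P" "A \<le> B"
  shows "(\<Prod>x\<in>{A..<B}. edge_weight P x) = (- 1) ^ nat (B - A)"
proof -
  have "{X. X \<subseteq> {A..<B} \<and> (\<forall>c\<in>P \<inter> {A..B}. card (X \<inter> {..<c}) = card ({A..<B} \<inter> {..<c}))} = {{A..<B}}"
  proof (intro equalityI subsetI)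
    fix X assume "X \<in> {X. X \<subseteq> {A..<B} \<and> (\<forall>c\<in>P \<inter> {A..B}. card (X \<inter> {..<c}) = card ({A..<B} \<inter> {..<c}))}"
    then have X: "X \<subseteq> {A..<B}" "card (X \<inter> {..<B}) = card ({A..<B} \<inter> {..<B})"
      using assms by auto
    moreover have "X \<inter> {..<B} = X" "{A..<B} \<inter> {..<B} = {A..<B}" using X(1) by auto
    ultimately show "X \<in> {{A..<B}}" by (simp add: card_subset_eq)
  qed auto
  then show ?thesis
    using sum_edge_weight_prescribed[OF assms order_refl] by simp
qed

section \<open>Partitions as column heights and as sets of steps\<close>

definition col :: "nat list \<Rightarrow> nat \<Rightarrow> nat" where
  "col p i = (if i < length p then p ! i else 0)"

definition content :: "nat \<times> nat \<Rightarrow> int" where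
  "content b = int (fst b) - int (snd b)"

lemma mem_young_iff: "(i, j) \<in> young p \<longleftrightarrow> j < col p i"
  by (simp add: young_def col_def)

lemma col_antimono:
  assumes "p \<in> partitions" "i \<le> k"
  shows "col p k \<le> col p i"
  using assms by (cases "i = k") (auto simp: col_def partitions_def sorted_wrt_iff_nth_less)

lemma col_eq_0_iff:
  assumes "p \<in> partitions"
  shows "col p i = 0 \<longleftrightarrow> length p \<le> i"
  using assms nth_mem[of i p] by (cases "p ! i") (auto simp: col_def partitions_def simp del: nth_mem)

lemma col_inject:
  assumes "p \<in> partitions" "q \<in> partitions" "col p = col q"
  shows "p = q"
proof -
  have len: "length p = length q"
    using col_eq_0_iff[OF assms(1)] col_eq_0_iff[OF assms(2)] assms(3) by (metis le_antisym le_refl)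
  show ?thesis
  proof (rule nth_equalityI[OF len])
    fix i assume "i < length p"
    then show "p ! i = q ! i" using fun_cong[OF assms(3), of i] len by (simp add: col_def)
  qed
qed

lemma partition_with_columns:
  fixes h :: "nat \<Rightarrow> nat"
  assumes "antimono h" "h L = 0"
  shows "\<exists>p\<in>partitions. col p = h"
proof -
  define K where "K = (LEAST k. h k = 0)"
  have K: "h K = 0" unfolding K_def by (rule LeastI[of _ L]) fact
  have pos: "h i \<noteq> 0" if "i < K" for i using that not_less_Least unfolding K_def by blast
  have zero: "h i = 0" if "K \<le> i" for i using antimonoD[OF assms(1) that] K by simp
  define p where "p = map h [0..<K]"
  have "p \<in> partitions"
    using assms(1) unfolding partitions_def p_def
    by (auto simp: sorted_wrt_iff_nth_less antimono_def dest: pos)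
  moreover have "col p = h"
    using zero by (auto simp: p_def col_def)
  ultimately show ?thesis by blast
qed

lemma down_closed_eq_lessThan:
  fixes S :: "nat set"
  assumes "finite S" "\<And>x y. x \<in> S \<Longrightarrow> y \<le> x \<Longrightarrow> y \<in> S"
  shows "S = {..<card S}"
proof (rule card_subset_eq[symmetric])
  show "{..<card S} \<subseteq> S"
  proof
    fix x assume x: "x \<in> {..<card S}"
    show "x \<in> S"
    proof (rule ccontr)
      assume "x \<notin> S"
      then have "S \<subseteq> {..<x}" using assms(2) by (metis lessThan_iff not_le subsetI)
      from card_mono[OF _ this] x show False by simp
    qed
  qed
qed (use assms in auto)

lemma young_down_closed:
  assumes "p \<in> partitions" "(i, j) \<in> young p" "i' \<le> i" "j' \<le> j"
  shows "(i', j') \<in> young p"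
  using assms col_antimono[OF assms(1,3)] by (simp add: mem_young_iff)

lemma partition_of_down_set:
  assumes fin: "finite D"
    and down: "\<And>i j i' j'. (i, j) \<in> D \<Longrightarrow> i' \<le> i \<Longrightarrow> j' \<le> j \<Longrightarrow> (i', j') \<in> D"
  shows "\<exists>p\<in>partitions. young p = D"
proof -
  define h where "h i = card {j. (i, j) \<in> D}" for i
  have finc: "finite {j. (i, j) \<in> D}" for i
    by (rule finite_subset[of _ "snd ` D"]) (use fin in force)+
  have h: "{j. (i, j) \<in> D} = {..<h i}" for i
    unfolding h_def using finc down by (intro down_closed_eq_lessThan) auto
  have "antimono h"
    unfolding antimono_def h_def using finc down by (auto intro!: card_mono)
  moreover have "\<exists>L. h L = 0"
  proof -
    obtain L where "L \<notin> fst ` D"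
      using ex_new_if_finite[OF infinite_UNIV_nat] fin by blast
    then have "{j. (L, j) \<in> D} = {}" by force
    then show ?thesis unfolding h_def by (metis card.empty)
  qed
  ultimately obtain p where p: "p \<in> partitions" "col p = h"
    using partition_with_columns by blast
  have "b \<in> young p \<longleftrightarrow> b \<in> D" for b
    using h[of "fst b"] p(2) by (cases b) (auto simp: mem_young_iff set_eq_iff)
  then show ?thesis using p(1) by blast
qed

lemma young_inject:
  assumes "p \<in> partitions" "q \<in> partitions" "young p = young q"
  shows "p = q"
proof (rule col_inject[OF assms(1,2)])
  have "j < col p i \<longleftrightarrow> j < col q i" for i j
    using assms(3) by (simp flip: mem_young_iff)
  then show "col p = col q" by (metis ext linorder_neqE_nat less_irrefl)
qed

text \<open>The boundary of a Young diagram is a lattice path along which the content rises by one with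
  each unit step. \<open>steps L p\<close> consists of the contents at which its first \<open>L\<close> horizontal steps
  start, the step on top of column \<open>i\<close> starting at \<open>(i, col p i)\<close>; it is the set of beads of the
  partition in the language of Maya diagrams.\<close>

definition steps :: "nat \<Rightarrow> nat list \<Rightarrow> int set" where
  "steps L p = (\<lambda>i. int i - int (col p i)) ` {..<L}"

lemma step_strict_mono:
  assumes "p \<in> partitions"
  shows "strict_mono (\<lambda>i. int i - int (col p i))"
  using col_antimono[OF assms] by (intro strict_monoI) (smt (verit) less_imp_le of_nat_less_iff of_nat_le_iff)

text \<open>The \<open>i\<close>-th smallest element of an \<open>L\<close>-element set of integers below \<open>L\<close> is at most \<open>i\<close>,
  and the deficit, which decreases weakly with \<open>i\<close>, is the height of column \<open>i\<close>.\<close>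

lemma bij_betw_steps:
  assumes "A \<le> 0"
  shows "bij_betw (steps L) {p \<in> partitions. col p L = 0 \<and> int (col p 0) \<le> - A}
    {X. X \<subseteq> {A..<int L} \<and> card X = L}" (is "bij_betw _ ?S ?T")
proof (rule bij_betw_imageI)
  show "inj_on (steps L) ?S"
  proof (rule inj_onI)
    fix p q assume p: "p \<in> ?S" and q: "q \<in> ?S" and eq: "steps L p = steps L q"
    let ?f = "\<lambda>p i. int i - int (col p i)"
    have sorted: "sorted_list_of_set (steps L p) = map (?f p) [0..<L]" if "p \<in> ?S" for p
    proof -
      have "sorted_wrt (<) (map (?f p) [0..<L])"
        using strict_monoD[OF step_strict_mono] that by (simp add: sorted_wrt_iff_nth_less)
      moreover have "set (map (?f p) [0..<L]) = steps L p"
        by (simp add: steps_def atLeast0LessThan)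
      ultimately show ?thesis
        by (intro strict_sorted_equal) (auto simp: steps_def)
    qed
    have "map (?f p) [0..<L] = map (?f q) [0..<L]"
      using sorted[OF p] sorted[OF q] eq by simp
    then have "col p i = col q i" if "i < L" for i
      using that by (simp add: map_eq_conv)
    moreover have "col p i = col q i" if "L \<le> i" for i
      using col_antimono[OF _ that, of p] col_antimono[OF _ that, of q] p q by simp
    ultimately have "col p = col q" by (metis ext not_le)
    then show "p = q" using p q col_inject by simp
  qed
  show "steps L ` ?S = ?T"
  proof (intro equalityI subsetI)
    fix X assume "X \<in> steps L ` ?S"
    then obtain p where p: "p \<in> ?S" "X = steps L p" by auto
    have "A \<le> int i - int (col p i)" "int i - int (col p i) < int L" if "i < L" for i
      using col_antimono[of p 0 i] p that by auto
    moreover have "card X = L"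
      using strict_mono_imp_inj_on[OF step_strict_mono] p by (simp add: steps_def card_image)
    ultimately show "X \<in> ?T" using p(2) by (auto simp: steps_def)
  next
    fix X assume X: "X \<in> ?T"
    define f where "f i = sorted_list_of_set X ! i" for i
    have finX: "finite X" using X finite_subset by blast
    have mono: "f i < f k" if "i < k" "k < L" for i k
      using that X sorted_list_of_set.strict_sorted_key_list_of_set[of X]
      unfolding f_def by (auto simp: sorted_wrt_iff_nth_less)
    have img: "X = f ` {..<L}"
      using X finX nth_image[of L "sorted_list_of_set X"]
      by (simp add: f_def lessThan_atLeast0)
    have gaps: "f i + int (k - i) \<le> f k" if "i \<le> k" "k < L" for i k
      using that
    proof (induction k rule: dec_induct)
      case (step k)
      then show ?case using mono[of k "Suc k"] by (simp add: Suc_diff_le)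
    qed simp
    have le: "f i \<le> int i" if "i < L" for i
    proof -
      have "f (L - 1) \<in> X" using img that by simp
      then have "f (L - 1) < int L" using X by auto
      then show ?thesis using gaps[of i "L - 1"] that by linarith
    qed
    define h where "h i = (if i < L then nat (int i - f i) else 0)" for i
    have "antimono h"
    proof (rule antimonoI)
      fix i k :: nat assume "i \<le> k"
      then show "h k \<le> h i" using gaps[of i k] by (auto simp: h_def)
    qed
    then obtain p where p: "p \<in> partitions" "col p = h"
      using partition_with_columns[of h L] by (auto simp: h_def)
    have "int (h 0) \<le> - A"
      using X img assms by (force simp: h_def)
    moreover have "int i - int (h i) = f i" if "i < L" for i
      using le[OF that] that by (simp add: h_def)
    ultimately have "p \<in> ?S" "steps L p = X"
      using p img by (auto simp: h_def steps_def)
    then show "X \<in> steps L ` ?S" by blast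
  qed
qed

definition coloured :: "int set \<Rightarrow> nat list \<Rightarrow> (nat \<times> nat) set" where
  "coloured P p = {b \<in> young p. content b \<in> P}"

lemma coloured_eq_iff:
  "coloured P p = coloured P q \<longleftrightarrow>
    (\<forall>i j. int i - int j \<in> P \<longrightarrow> (j < col p i \<longleftrightarrow> j < col q i))"
  unfolding coloured_def set_eq_iff by (auto simp: content_def mem_young_iff)

text \<open>The columns whose step starts below \<open>c\<close> form an initial segment, hence are determined by
  their number. They are the columns \<open>i < c\<close> together with those meeting the diagonal of content
  \<open>c\<close>.\<close>

lemma card_steps_below_eq_iff:
  assumes "p \<in> partitions" "q \<in> partitions"
  shows "card (steps L p \<inter> {..<c}) = card (steps L q \<inter> {..<c}) \<longleftrightarrow>
    (\<forall>i j. i < L \<and> int i - int j = c \<longrightarrow> (j < col p i \<longleftrightarrow> j < col q i))"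
proof -
  define S where "S p = {i. i < L \<and> int i - int (col p i) < c}" for p
  have card: "card (steps L p \<inter> {..<c}) = card (S p)" and seg: "S p = {..<card (S p)}"
    if p: "p \<in> partitions" for p
  proof -
    have "steps L p \<inter> {..<c} = (\<lambda>i. int i - int (col p i)) ` S p"
      by (auto simp: steps_def S_def)
    then show "card (steps L p \<inter> {..<c}) = card (S p)"
      using strict_mono_imp_inj_on[OF step_strict_mono[OF p]] inj_on_subset by (metis card_image subset_UNIV)
    have "int y - int (col p y) \<le> int x - int (col p x)" if "y \<le> x" for x y
      using strict_mono_less_eq[OF step_strict_mono[OF p], of y x] that by simp
    then show "S p = {..<card (S p)}"
      by (intro down_closed_eq_lessThan) (force simp: S_def)+
  qed
  have "card (S p) = card (S q) \<longleftrightarrow> S p = S q"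
    using seg assms by metis
  also have "\<dots> \<longleftrightarrow> (\<forall>i j. i < L \<and> int i - int j = c \<longrightarrow> (j < col p i \<longleftrightarrow> j < col q i))"
  proof
    assume eq: "S p = S q"
    show "\<forall>i j. i < L \<and> int i - int j = c \<longrightarrow> (j < col p i \<longleftrightarrow> j < col q i)"
    proof (intro allI impI)
      fix i j assume "i < L \<and> int i - int j = c"
      then show "j < col p i \<longleftrightarrow> j < col q i"
        using eq[unfolded set_eq_iff, rule_format, of i] by (auto simp: S_def)
    qed
  next
    assume *: "\<forall>i j. i < L \<and> int i - int j = c \<longrightarrow> (j < col p i \<longleftrightarrow> j < col q i)"
    show "S p = S q"
    proof (rule set_eqI)
      fix i
      show "i \<in> S p \<longleftrightarrow> i \<in> S q"
        using *[rule_format, of i "nat (int i - c)"] by (cases "int i < c") (auto simp: S_def)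
    qed
  qed
  finally show ?thesis using card assms by simp
qed

text \<open>The contents in column \<open>i\<close> run from \<open>i\<close> down to \<open>i - col p i + 1\<close>, so that the product over
  this column telescopes to the ratio of the weights at \<open>i - col p i\<close> and \<open>i\<close>.\<close>

lemma prod_content_eq_prod_steps:
  fixes W y :: "int \<Rightarrow> 'a :: field"
  assumes p: "p \<in> partitions" "col p L = 0"
    and y: "\<And>c. y c * W c = W (c - 1)" and W: "\<And>c. W c \<noteq> 0"
  shows "(\<Prod>b\<in>young p. y (content b)) = (\<Prod>x\<in>steps L p. W x) / (\<Prod>i<L. W (int i))"
proof -
  have column: "(\<Prod>j<k. y (c - int j)) = W (c - int k) / W c" for c k
  proof (induction k)
    case (Suc k)
    have "y (c - int k) = W (c - int (Suc k)) / W (c - int k)"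
      using y[of "c - int k"] W[of "c - int k"] by (simp add: field_simps)
    then show ?case using Suc W[of "c - int k"] by simp
  qed (simp add: W)
  have "young p = Sigma {..<L} (\<lambda>i. {..<col p i})"
  proof -
    have "i < L" if "j < col p i" for i j
      using that col_antimono[OF p(1), of L i] p(2) by (metis leI le_zero_eq not_less_zero)
    then show ?thesis by (auto simp: mem_young_iff)
  qed
  then have "(\<Prod>b\<in>young p. y (content b)) = (\<Prod>i<L. \<Prod>j<col p i. y (int i - int j))"
    by (simp add: prod.Sigma content_def case_prod_beta)
  also have "\<dots> = (\<Prod>i<L. W (int i - int (col p i)) / W (int i))"
    by (simp add: column)
  also have "\<dots> = (\<Prod>i<L. W (int i - int (col p i))) / (\<Prod>i<L. W (int i))"
    by (rule prod_dividef)
  also have "(\<Prod>i<L. W (int i - int (col p i))) = (\<Prod>x\<in>steps L p. W x)"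
    unfolding steps_def using strict_mono_imp_inj_on[OF step_strict_mono[OF p(1)]]
    by (subst prod.reindex) (auto intro: inj_on_subset)
  finally show ?thesis .
qed

section \<open>Partitions with prescribed coloured blocks\<close>

text \<open>In terms of step sets, prescribing the coloured blocks is prescribing the numbers of steps
  below the members of \<open>P\<close>. The resulting sum depends on the partition \<open>p\<close> only through the sign
  \<open>(- 1) ^ L\<close>, where \<open>L\<close> is the number of columns considered, and the part of the denominator
  between \<open>m\<close> and \<open>L\<close> cancels this sign up to \<open>(- 1) ^ m\<close>.\<close>

lemma sum_over_fibre:
  assumes P: "unbounded_both P" and p: "p \<in> partitions" and m: "int m \<in> P"
    and y: "\<And>c. y c * edge_weight P c = edge_weight P (c - 1)"
  shows "(\<Sum>q | q \<in> partitions \<and> coloured P q = coloured P p. \<Prod>b\<in>young q. y (content b))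
    = (- 1) ^ m / (\<Prod>i<m. edge_weight P (int i))"
proof -
  \<comment> \<open>All diagonals met by \<open>p\<close> have contents strictly between \<open>A\<close> and \<open>L\<close>.\<close>
  obtain A where A: "A \<in> P" "A \<le> - int (col p 0)"
    using P unfolding unbounded_both_def by blast
  obtain L' where L': "L' \<in> P" "int (max (length p) m) < L'"
    using P unfolding unbounded_both_def by blast
  define L where "L = nat L'"
  have L: "int L \<in> P" "length p \<le> L" "m \<le> L"
    using L' by (auto simp: L_def)
  have pL: "col p L = 0" using L(2) by (simp add: col_def)
  define S where "S = {q \<in> partitions. col q L = 0 \<and> int (col q 0) \<le> - A}"
  define F where "F = {q \<in> partitions. coloured P q = coloured P p}"
  define X0 where "X0 = steps L p"
  define T where "T = {X. X \<subseteq> {A..<int L} \<and>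
      (\<forall>c\<in>P \<inter> {A..int L}. card (X \<inter> {..<c}) = card (X0 \<inter> {..<c}))}"
  have A0: "A \<le> 0" using A by simp
  have bij: "bij_betw (steps L) S {X. X \<subseteq> {A..<int L} \<and> card X = L}"
    unfolding S_def by (rule bij_betw_steps[OF A0])
  have pS: "p \<in> S" using p pL A by (simp add: S_def)
  then have X0: "X0 \<subseteq> {A..<int L}" "card X0 = L"
    using bij bij_betwE unfolding X0_def by blast+
  have FS: "F \<subseteq> S"
  proof
    fix q assume "q \<in> F"
    then have q: "q \<in> partitions" "coloured P p = coloured P q" by (auto simp: F_def)
    \<comment> \<open>The diagonals of contents \<open>L\<close> and \<open>A\<close> are coloured and do not meet \<open>p\<close>.\<close>
    have "\<not> 0 < col q L"
      using q(2) L(1) pL unfolding coloured_eq_iff by (metis diff_0_right less_irrefl of_nat_0)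
    moreover have "\<not> nat (- A) < col q 0"
      using q(2)[unfolded coloured_eq_iff, rule_format, of 0 "nat (- A)"] A A0 by auto
    ultimately show "q \<in> S" using q(1) A0 by (auto simp: S_def)
  qed
  have iff: "q \<in> F \<longleftrightarrow> steps L q \<in> T" if q: "q \<in> S" for q
  proof -
    have qp: "q \<in> partitions" using q by (simp add: S_def)
    have sub: "steps L q \<subseteq> {A..<int L}" using bij_betwE[OF bij] q by blast
    have "q \<in> F \<longleftrightarrow> (\<forall>i j. int i - int j \<in> P \<longrightarrow> (j < col q i \<longleftrightarrow> j < col p i))"
      using qp by (simp add: F_def coloured_eq_iff)
    also have "\<dots> \<longleftrightarrow> (\<forall>c\<in>P \<inter> {A..int L}. \<forall>i j. i < L \<and> int i - int j = c \<longrightarrow>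
        (j < col q i \<longleftrightarrow> j < col p i))" (is "?l \<longleftrightarrow> ?r")
    proof
      assume ?r
      show ?l
      proof (intro allI impI)
        fix i j assume ij: "int i - int j \<in> P"
        have zero: "col r i = 0" if "r \<in> S" "L \<le> i" for r
          using that col_antimono[of r L i] by (simp add: S_def)
        have top: "int (col r i) \<le> - A" if "r \<in> S" for r
          using that col_antimono[of r 0 i] by (simp add: S_def)
        show "j < col q i \<longleftrightarrow> j < col p i"
        proof (cases "i < L \<and> A \<le> int i - int j")
          case True
          then show ?thesis using \<open>?r\<close>[rule_format, of "int i - int j" i j] ij by simp
        next
          case False
          then show ?thesis using zero[OF q] zero[OF pS] top[OF q] top[OF pS] by auto
        qed
      qed
    qed blast
    also have "\<dots> \<longleftrightarrow> steps L q \<in> T"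
      unfolding T_def X0_def using sub by (simp add: card_steps_below_eq_iff[OF qp p])
    finally show ?thesis .
  qed
  have "T \<subseteq> steps L ` S"
  proof
    fix X assume X: "X \<in> T"
    then have "X \<inter> {..<int L} = X" "X0 \<inter> {..<int L} = X0" using X0 by (auto simp: T_def)
    moreover have "card (X \<inter> {..<int L}) = card (X0 \<inter> {..<int L})"
      using X L(1) A0 by (auto simp: T_def)
    ultimately have "card X = L" using X0 by simp
    then show "X \<in> steps L ` S"
      using X bij by (auto simp: T_def bij_betw_def)
  qed
  then have "steps L ` F = T" using iff FS by blast
  then have bijF: "bij_betw (steps L) F T"
    using bij_betw_subset[OF bij FS] by simp
  have LA: "A \<le> int L" using A0 by simp
  have "(\<Sum>q\<in>F. \<Prod>b\<in>young q. y (content b))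
      = (\<Sum>q\<in>F. (\<Prod>x\<in>steps L q. edge_weight P x) / (\<Prod>i<L. edge_weight P (int i)))"
    using FS y by (intro sum.cong prod_content_eq_prod_steps) (auto simp: S_def)
  also have "\<dots> = (\<Sum>X\<in>T. \<Prod>x\<in>X. edge_weight P x) / (\<Prod>i<L. edge_weight P (int i))"
    by (simp add: sum.reindex_bij_betw[OF bijF] flip: sum_divide_distrib)
  also have "(\<Sum>X\<in>T. \<Prod>x\<in>X. edge_weight P x) = (- 1) ^ L"
    unfolding T_def using sum_edge_weight_prescribed[OF P A(1) L(1) LA X0(1)] X0(2) by simp
  also have "(\<Prod>i<L. edge_weight P (int i)) = (\<Prod>i<m. edge_weight P (int i)) * (- 1) ^ (L - m)"
  proof -
    have "{..<L} = {..<m} \<union> {m..<L}" using L(3) by auto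
    then have "(\<Prod>i<L. edge_weight P (int i))
        = (\<Prod>i<m. edge_weight P (int i)) * (\<Prod>i=m..<L. edge_weight P (int i))"
      by (simp add: prod.union_disjoint ivl_disj_int)
    also have "(\<Prod>i=m..<L. edge_weight P (int i)) = (\<Prod>x\<in>{int m..<int L}. edge_weight P x)"
      by (rule prod.reindex_bij_witness[of _ nat int]) auto
    finally show ?thesis
      using prod_edge_weight_between[OF P m L(1)] L(3) by (simp add: nat_diff_distrib')
  qed
  also have "(- 1 :: complex) ^ L = (- 1) ^ m * (- 1) ^ (L - m)"
    using L(3) by (simp flip: power_add)
  finally show ?thesis by (simp add: F_def)
qed

text \<open>In a counterexample take a block of \<open>p\<close> outside \<open>q\<close> of least coordinate sum: it is
  addable to \<open>q\<close>, hence coloured, hence in \<open>q\<close>.\<close>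

lemma coloured_young_subset:
  assumes p: "p \<in> partitions" and q: "q \<in> partitions"
    and eq: "coloured P p = coloured P q" and gen: "\<forall>b\<in>addable q. content b \<in> P"
  shows "young p \<subseteq> young q"
proof (rule ccontr)
  assume "\<not> ?thesis"
  then obtain b0 where "b0 \<in> young p - young q" by blast
  then obtain b where b: "b \<in> young p - young q"
    and least: "\<And>b'. b' \<in> young p - young q \<Longrightarrow> fst b + snd b \<le> fst b' + snd b'"
    using ex_has_least_nat[of "\<lambda>b. b \<in> young p - young q" b0 "\<lambda>b. fst b + snd b"] by blast
  obtain i j where ij: "b = (i, j)" by (cases b)
  have "\<exists>r\<in>partitions. young r = insert b (young q)"
  proof (rule partition_of_down_set)
    fix k l k' l' assume kl: "(k, l) \<in> insert b (young q)" "k' \<le> k" "l' \<le> l"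
    show "(k', l') \<in> insert b (young q)"
    proof (cases "(k, l) \<in> young q")
      case True
      then show ?thesis using young_down_closed[OF q True kl(2,3)] by simp
    next
      case False
      then have "k = i" "l = j" using kl(1) ij by auto
      moreover from this have "(k', l') \<in> young p"
        using young_down_closed[OF p _ kl(2,3)] b ij by simp
      ultimately show ?thesis
        using least[of "(k', l')"] kl(2,3) ij by fastforce
    qed
  qed (simp add: finite_young)
  then have "b \<in> addable q" using b by (auto simp: addable_def)
  then have "b \<in> coloured P p" using gen b by (auto simp: coloured_def)
  then have "b \<in> coloured P q" using eq by simp
  then show False using b by (simp add: coloured_def)
qed

lemma generated_partition_unique:
  assumes "p \<in> partitions" "q \<in> partitions" "coloured P p = coloured P q"
    and "\<forall>b\<in>addable p. content b \<in> P" "\<forall>b\<in>addable q. content b \<in> P"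
  shows "p = q"
  using coloured_young_subset[of p q P] coloured_young_subset[of q p P] assms
  by (intro young_inject) auto

text \<open>A largest partition with the given coloured blocks admits no further uncoloured block.\<close>

lemma generated_partition_exists:
  assumes p: "p \<in> partitions" and fin: "finite {q \<in> partitions. coloured P q = coloured P p}"
  shows "\<exists>g\<in>partitions. coloured P g = coloured P p \<and> (\<forall>b\<in>addable g. content b \<in> P)"
proof -
  let ?F = "{q \<in> partitions. coloured P q = coloured P p}"
  let ?N = "(\<lambda>q. card (young q)) ` ?F"
  have N: "finite ?N" "?N \<noteq> {}" using p fin by auto
  from Max_in[OF this] obtain g where "Max ?N = card (young g)" and g: "g \<in> ?F"
    by (rule imageE)
  then have max: "card (young q) \<le> card (young g)" if "q \<in> ?F" for q
    using Max_ge[OF N(1)] that by auto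
  have "content b \<in> P" if "b \<in> addable g" for b
  proof (rule ccontr)
    assume b: "content b \<notin> P"
    obtain q where q: "q \<in> partitions" "young q = insert b (young g)" "b \<notin> young g"
      using \<open>b \<in> addable g\<close> unfolding addable_def by blast
    have "q \<in> ?F" using q g b by (auto simp: coloured_def)
    from max[OF this] q(2,3) show False by (simp add: finite_young)
  qed
  then show ?thesis using g by blast
qed

section \<open>The scalars of the substitution as ratios of edge weights\<close>

lemma I0_lift_eq:
  "I0_lift n Ip = - preimage_mod n Ip"
  using pos_mod_bound[of "int n + 1"] by (auto simp: preimage_mod_def nat_le_iff)

lemma preimage_mod_shift:
  "c + t * (int n + 1) \<in> preimage_mod n J \<longleftrightarrow> c \<in> preimage_mod n J"
  by (simp add: preimage_mod_def)

lemma unbounded_preimage_mod: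
  assumes "Ip \<noteq> {}" "Ip \<subseteq> {0..n}"
  shows "unbounded_both (preimage_mod n Ip)"
proof -
  obtain k where k: "k \<in> Ip" "k \<le> n" using assms by fastforce
  show ?thesis
    unfolding unbounded_both_def
  proof (intro allI conjI)
    fix x :: int
    define a where "a = x - (x - int k) mod (int n + 1)"
    have "a mod (int n + 1) = int k mod (int n + 1)"
      unfolding a_def by (simp add: mod_simps)
    then have a: "a \<in> preimage_mod n Ip"
      using k by (simp add: preimage_mod_def)
    moreover have "a \<le> x" "x < a + 1 * (int n + 1)"
      unfolding a_def using pos_mod_bound[of "int n + 1" "x - int k"] by auto
    ultimately show "\<exists>a\<in>preimage_mod n Ip. a \<le> x" "\<exists>b\<in>preimage_mod n Ip. x < b"
      using preimage_mod_shift[of a 1 n Ip] by blast+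
  qed
qed

lemma gap_preimage_mod_shift:
  assumes "gap (preimage_mod n J) a b"
  shows "gap (preimage_mod n J) (a + t * (int n + 1)) (b + t * (int n + 1))"
proof -
  have "c \<notin> preimage_mod n J" if "a + t * (int n + 1) < c" "c < b + t * (int n + 1)" for c
    using assms that preimage_mod_shift[of "c - t * (int n + 1)" t n J]
    by (auto simp: gap_def set_eq_iff)
  then show ?thesis
    using assms by (auto simp: gap_def preimage_mod_shift)
qed

lemma r_num_gap:
  assumes "gap (preimage_mod n Ip) a b"
  shows "r_num n Ip a = b - a - 1"
proof -
  have "r_set n Ip a = {a..b - 1}"
  proof (intro equalityI subsetI)
    fix j assume j: "j \<in> r_set n Ip a"
    have "\<not> b \<le> j"
    proof
      assume "b \<le> j"
      then have "b \<in> {a + 1..j}" using assms by (simp add: gap_def)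
      then show False using j assms unfolding r_set_def I0_lift_eq gap_def by blast
    qed
    then show "j \<in> {a..b - 1}" using j by (simp add: r_set_def)
  qed (use assms in \<open>auto simp: r_set_def I0_lift_eq gap_def set_eq_iff\<close>)
  moreover have "Max {a..b - 1} = b - 1"
    using assms by (intro Max_eqI) (auto simp: gap_def)
  ultimately show ?thesis by (simp add: r_num_def)
qed

lemma l_num_gap:
  assumes "gap (preimage_mod n Ip) a b"
  shows "l_num n Ip b = b - a - 1"
proof -
  have "l_set n Ip b = {a + 1..b}"
  proof (intro equalityI subsetI)
    fix j assume j: "j \<in> l_set n Ip b"
    have "\<not> j \<le> a"
    proof
      assume "j \<le> a"
      then have "a \<in> {j..b - 1}" using assms by (simp add: gap_def)
      then show False using j assms unfolding l_set_def I0_lift_eq gap_def by blast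
    qed
    then show "j \<in> {a + 1..b}" using j by (simp add: l_set_def)
  qed (use assms in \<open>auto simp: l_set_def I0_lift_eq gap_def set_eq_iff\<close>)
  moreover have "Min {a + 1..b} = a + 1"
    using assms by (intro Min_eqI) (auto simp: gap_def)
  ultimately show ?thesis by (simp add: l_num_def)
qed

lemma n_num_gap:
  assumes "gap (preimage_mod n Ip) a b" "a < i" "i < b"
  shows "n_num n Ip i = nat (b - a - 1)"
  unfolding n_num_def
proof (rule Max_eqI)
  have run: "R \<subseteq> {a + 1..b - 1}" if R: "R \<in> runs n Ip i" for R
  proof -
    obtain c d where R': "R = {c..d}" "c \<le> i" "i \<le> d" "{c..d} \<subseteq> - preimage_mod n Ip"
      using R unfolding runs_def I0_lift_eq by blast
    have "a \<notin> {c..d}" "b \<notin> {c..d}" using R'(4) assms(1) by (auto simp: gap_def)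
    then show ?thesis using R' assms by auto
  qed
  have "runs n Ip i \<subseteq> Pow {a + 1..b - 1}" using run by blast
  then show "finite (card ` runs n Ip i)"
    by (intro finite_imageI) (rule finite_subset, auto)
  show "k \<le> nat (b - a - 1)" if "k \<in> card ` runs n Ip i" for k
  proof -
    from that obtain R where "R \<in> runs n Ip i" "k = card R" by auto
    then show ?thesis using card_mono[OF _ run] by fastforce
  qed
  have "{a + 1..b - 1} \<in> runs n Ip i"
    unfolding runs_def I0_lift_eq mem_Collect_eq
    by (intro exI[of _ "a + 1"] exI[of _ "b - 1"]) (use assms in \<open>auto simp: gap_def set_eq_iff\<close>)
  then show "nat (b - a - 1) \<in> card ` runs n Ip i"
    by (rule rev_image_eqI) simp
qed

lemma exp_eq_unity_root:
  "exp (2 * of_real pi * \<i> / of_nat N) = unity_root N"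
  "0 \<le> k \<Longrightarrow> exp (2 * of_real pi * \<i> / of_int k) = unity_root (nat k)"
  by (simp_all add: unity_root_def)

text \<open>At a member \<open>c\<close> of \<open>P\<close> the weight jumps from the lowest power for the gap on its left to the
  highest power for the gap on its right, which equals the root of unity itself.\<close>

lemma s_scalar_edge_weight:
  assumes "Ip \<noteq> {}" "Ip \<subseteq> {0..n}"
  defines "P \<equiv> preimage_mod n Ip"
  shows "inverse (s_scalar n Ip (nat (c mod (int n + 1)))) * edge_weight P c = edge_weight P (c - 1)"
proof -
  have U: "unbounded_both P" unfolding P_def by (rule unbounded_preimage_mod[OF assms(1,2)])
  define t where "t = - (c div (int n + 1))"
  define c0 where "c0 = nat (c mod (int n + 1))"
  have c0: "int c0 = c + t * (int n + 1)"
  proof -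
    have "int c0 = c mod (int n + 1)" by (simp add: c0_def)
    then show ?thesis using minus_div_mult_eq_mod[of c "int n + 1"] by (simp add: t_def)
  qed
  have shift: "gap P (a + t * (int n + 1)) (b + t * (int n + 1))" if "gap P a b" for a b
    using that unfolding P_def by (rule gap_preimage_mod_shift)
  have mem: "c0 \<in> Ip \<longleftrightarrow> c \<in> P" by (simp add: c0_def P_def preimage_mod_def)
  define b where "b = gap_end P c"
  have cb: "c < b" using gap_around[OF U, of c] by (simp add: b_def)
  have "inverse (s_scalar n Ip c0) * edge_weight P c = edge_weight P (c - 1)"
  proof (cases "c \<in> P")
    case False
    define a where "a = gap_start P c"
    have gap: "gap P a b" "a \<le> c" using gap_around[OF U, of c] by (auto simp: a_def b_def)
    then have ac: "a < c" using False by (auto simp: gap_def order_le_less)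
    have "n_num n Ip (int c0) = nat (b - a - 1)"
      using n_num_gap[OF shift[OF gap(1), unfolded P_def], of "int c0"] ac cb c0 by simp
    then have "s_scalar n Ip c0 = unity_root (nat (b - a - 1) + 2)"
      using False mem by (simp only: s_scalar_def exp_eq_unity_root if_False)
    moreover have "nat (b - a - 1) + 2 = nat (b - a + 1)" using ac cb by simp
    ultimately have "s_scalar n Ip c0 = unity_root (nat (b - a + 1))" by simp
    moreover have "nat (b - (c - 1)) = Suc (nat (b - c))" using cb by simp
    ultimately show ?thesis
      using edge_weight_gap[OF gap(1), of c] edge_weight_gap[OF gap(1), of "c - 1"] ac cb by simp
  next
    case True
    define a where "a = gap_start P (c - 1)"
    have left: "gap P a c" "a < c"
      using gap_around[OF U, of "c - 1"] True unfolding a_def gap_def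
      by (auto simp: set_eq_iff)
    have right: "gap P c b"
      using gap_around[OF U, of c] True unfolding b_def gap_def
      by (auto simp: set_eq_iff order_le_less)
    define M where "M = nat (c - a + 1)"
    define N where "N = nat (b - c + 1)"
    have rl: "r_num n Ip (int c0) + 2 = b - c + 1" "l_num n Ip (int c0) + 2 = c - a + 1"
      using r_num_gap[OF shift[OF right, unfolded P_def]] l_num_gap[OF shift[OF left(1), unfolded P_def]]
      by (simp_all add: c0)
    have "s_scalar n Ip c0 = unity_root N * unity_root M"
      unfolding s_scalar_def rl exp_add using True mem left(2) cb
      by (simp add: exp_eq_unity_root(2) M_def N_def del: of_int_add of_int_diff)
    moreover have "edge_weight P (c - 1) = inverse (unity_root M)"
      using edge_weight_gap[OF left(1), of "c - 1"] left(2) by (simp add: M_def)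
    moreover have "edge_weight P c = unity_root N"
    proof -
      have N: "N = Suc (nat (b - c))" using cb by (simp add: N_def)
      have "edge_weight P c = inverse (unity_root N) ^ nat (b - c)"
        using edge_weight_gap[OF right, of c] cb by (simp add: N_def)
      also have "\<dots> = unity_root N"
        using unity_root_power[of N] N by (simp add: power_inverse field_simps)
      finally show ?thesis .
    qed
    ultimately show ?thesis by (simp add: field_simps)
  qed
  then show ?thesis by (simp add: c0_def)
qed

text \<open>The numbers \<open>0, \<dots>, m - 1\<close> below \<open>m = Min Ip\<close> lie in one gap, which ends at \<open>m\<close>; the exponents
  of their weights are \<open>m, \<dots>, 1\<close> and add up to \<open>m * (m + 1) / 2\<close>.\<close>

lemma c_root_eq_prod_edge_weight:
  assumes "Ip \<noteq> {}" "Ip \<subseteq> {0..n}"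
  shows "c_root n Ip = (- 1) ^ Min Ip / (\<Prod>i<Min Ip. edge_weight (preimage_mod n Ip) (int i))"
proof (cases "Min Ip = 0")
  case True
  then show ?thesis by (simp add: c_root_def)
next
  case False
  define P where "P = preimage_mod n Ip"
  define m where "m = Min Ip"
  have finI: "finite Ip" using assms(2) finite_subset by blast
  have m: "m \<in> Ip" "m \<le> n" "0 < m"
    using Min_in[OF finI assms(1)] assms(2) False by (auto simp: m_def)
  have mP: "int m \<in> P" using m by (simp add: P_def preimage_mod_def)
  have none: "c \<notin> P" if "0 \<le> c" "c < int m" for c
  proof
    assume "c \<in> P"
    then have "nat c \<in> Ip" using that m by (simp add: P_def preimage_mod_def)
    then show False using Min_le[OF finI] that by (force simp: m_def)
  qed
  define a where "a = gap_start P (int m - 1)"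
  have gap: "gap P a (int m)" "a < 0"
  proof -
    note g = gap_around[OF unbounded_preimage_mod[OF assms], of "int m - 1", folded P_def a_def]
    then have "gap_end P (int m - 1) = int m"
      using mP unfolding gap_def by (auto simp: set_eq_iff) (smt (verit))
    then show "gap P a (int m)" using g by (simp add: a_def)
    then show "a < 0" using none[of a] by (force simp: gap_def)
  qed
  define N where "N = nat (int m - a + 1)"
  have N: "l_num n Ip (int m) + 2 = int N"
    using l_num_gap[OF gap(1)[unfolded P_def]] gap(2) by (simp add: N_def)
  have N0: "N > 0" using gap(2) by (simp add: N_def)
  define k where "k = (\<Sum>i<m. m - i)"
  have k: "m * (m + 1) = 2 * k"
  proof -
    have "k = (\<Sum>i\<in>{1..m}. i)"
      unfolding k_def by (rule sum.reindex_bij_witness[of _ "\<lambda>i. m - i" "\<lambda>i. m - i"]) auto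
    then show ?thesis using gauss_sum_from_Suc_0[of m, where ?'a = nat] by simp
  qed
  have "edge_weight P (int i) = inverse (unity_root N) ^ (m - i)" if "i < m" for i
    using edge_weight_gap[OF gap(1), of "int i"] gap(2) that
    by (simp add: N_def nat_diff_distrib')
  then have "(\<Prod>i<m. edge_weight P (int i)) = inverse (unity_root N ^ k)"
    by (simp add: k_def power_inverse[symmetric] flip: power_sum)
  moreover have "exp (2 * of_real pi * \<i> * (of_nat (m * (m + 1)) / of_int (2 * (l_num n Ip (int m) + 2))))
      = unity_root N ^ k"
  proof -
    have "2 * of_real pi * \<i> * (of_nat (m * (m + 1)) / of_int (2 * (l_num n Ip (int m) + 2)))
        = of_nat k * (2 * of_real pi * \<i> / of_nat N)"
      unfolding N k using N0 by (simp add: field_simps)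
    then show ?thesis by (simp only: unity_root_def exp_of_nat_mult)
  qed
  ultimately show ?thesis
    by (simp add: c_root_def Let_def P_def[symmetric] m_def[symmetric] inverse_eq_divide)
qed

section \<open>The substituted series\<close>

lemma wt_coloured_cong:
  assumes "coloured (preimage_mod n Ip) p = coloured (preimage_mod n Ip) q"
  shows "wt n Ip p = wt n Ip q"
proof -
  have "{b \<in> young p. label n b = j} = {b \<in> coloured (preimage_mod n Ip) p. label n b = j}"
    if "j \<in> Ip" for p j
    using that by (auto simp: coloured_def preimage_mod_def label_def content_def)
  then show ?thesis using assms by (auto simp: wt_def restr_def fun_eq_iff)
qed

lemma prod_powi_wt:
  fixes z :: "nat \<Rightarrow> complex"
  shows "(\<Prod>i\<in>{0..n}. z i powi (- int (wt n {0..n} p i))) = (\<Prod>b\<in>young p. inverse (z (label n b)))"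
proof -
  have "z i powi (- int (wt n {0..n} p i)) = (\<Prod>b | b \<in> young p \<and> label n b = i. inverse (z (label n b)))"
    if "i \<in> {0..n}" for i
  proof -
    have "(\<Prod>b | b \<in> young p \<and> label n b = i. inverse (z (label n b)))
        = (\<Prod>b | b \<in> young p \<and> label n b = i. inverse (z i))"
      by (rule prod.cong) auto
    then show ?thesis
      using that by (simp add: wt_def restr_def power_int_minus power_inverse)
  qed
  then have "(\<Prod>i\<in>{0..n}. z i powi (- int (wt n {0..n} p i)))
      = (\<Prod>i\<in>{0..n}. \<Prod>b | b \<in> young p \<and> label n b = i. inverse (z (label n b)))"
    by (rule prod.cong[OF refl])
  also have "\<dots> = (\<Prod>b\<in>young p. inverse (z (label n b)))"
  proof (rule prod.group[OF finite_young])
    have "c mod (int n + 1) \<le> int n" for c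
      using pos_mod_bound[of "int n + 1" c] by linarith
    then show "label n ` young p \<subseteq> {0..n}" by (auto simp: label_def nat_le_iff)
  qed simp
  finally show ?thesis .
qed

text \<open>The substituted series, written as a sum over partitions instead of over exponent vectors.\<close>

lemma subst_series_Z_all:
  assumes "Ip \<noteq> {}" "Ip \<subseteq> {0..n}"
  shows "subst_series n Ip z (Z_all n) v
    = (\<Sum>p | p \<in> partitions \<and> wt n Ip p = v. \<Prod>b\<in>young p. inverse (z (label n b)))"
proof -
  let ?w = "\<lambda>p. \<Prod>b\<in>young p. inverse (z (label n b))"
  let ?U = "{u. Z_all n u \<noteq> 0 \<and> restr Ip u = v}"
  let ?S = "{p \<in> partitions. wt n Ip p = v}"
  have restr: "restr Ip (wt n {0..n} p) = wt n Ip p" for p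
    using assms(2) by (fastforce simp: wt_def restr_def fun_eq_iff)
  have fin: "finite {p \<in> partitions. wt n {0..n} p = u}" for u
    by (rule finite_weight_fibre) auto
  have "Z_all n u * (\<Prod>i\<in>{0..n}. z i powi (- int (u i))) = (\<Sum>p | p \<in> ?S \<and> wt n {0..n} p = u. ?w p)"
    if "u \<in> ?U" for u
  proof -
    have "(\<Sum>p | p \<in> ?S \<and> wt n {0..n} p = u. ?w p)
        = (\<Sum>p | p \<in> partitions \<and> wt n {0..n} p = u. \<Prod>i\<in>{0..n}. z i powi (- int (u i)))"
      using that restr by (intro sum.cong) (auto simp: prod_powi_wt[symmetric])
    then show ?thesis by (simp add: Z_all_def gen_series_def)
  qed
  then have "subst_series n Ip z (Z_all n) v
      = (\<Sum>u\<in>?U. \<Sum>p | p \<in> ?S \<and> wt n {0..n} p = u. ?w p)"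
    unfolding subst_series_def by (rule sum.cong[OF refl])
  also have "\<dots> = (\<Sum>p\<in>?S. ?w p)"
  proof (rule sum.group)
    show "wt n {0..n} ` ?S \<subseteq> ?U"
      using restr fin by (auto simp: Z_all_def gen_series_def)
  qed (use finite_weight_fibre[OF assms] finite_subst_support[OF assms] in simp_all)
  finally show ?thesis .
qed

theorem theorem4p6:
  fixes n :: nat and Ip :: "nat set"
  assumes "n \<ge> 1" and "Ip \<noteq> {}" and "Ip \<subset> {0..n}"
  shows "Z_generated n Ip =
    (\<lambda>v. inverse (c_root n Ip) * subst_series n Ip (s_scalar n Ip) (Z_all n) v)"
proof
  fix v
  define P where "P = preimage_mod n Ip"
  define w where "w p = (\<Prod>b\<in>young p. inverse (s_scalar n Ip (label n b)))" for p
  define G where "G = {p \<in> generated_partitions n Ip. wt n Ip p = v}"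
  define F where "F g = {q \<in> partitions. coloured P q = coloured P g}" for g
  have Ip: "Ip \<noteq> {}" "Ip \<subseteq> {0..n}" using assms by auto
  have P: "unbounded_both P" unfolding P_def by (rule unbounded_preimage_mod[OF Ip])
  have m: "int (Min Ip) \<in> P"
    using Min_in[of Ip] Ip finite_subset[OF Ip(2)] by (fastforce simp: P_def preimage_mod_def)
  have label: "label n b \<in> Ip \<longleftrightarrow> content b \<in> P" for b
    by (simp add: label_def content_def P_def preimage_mod_def)
  have G: "g \<in> G \<longleftrightarrow> g \<in> partitions \<and> (\<forall>b\<in>addable g. content b \<in> P) \<and> wt n Ip g = v" for g
    by (auto simp: G_def generated_partitions_def label)
  have finv: "finite {p \<in> partitions. wt n Ip p = u}" for u
    by (rule finite_weight_fibre[OF Ip])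
  have wtF: "wt n Ip q = wt n Ip g" if "q \<in> F g" for q g
    using that wt_coloured_cong[of n Ip q g] by (simp add: F_def P_def)
  have finF: "finite (F g)" for g
    by (rule finite_subset[OF _ finv[of "wt n Ip g"]]) (use wtF in \<open>auto simp: F_def\<close>)
  have fibre: "(\<Sum>q\<in>F g. w q) = c_root n Ip" if "g \<in> G" for g
  proof -
    have "w q = (\<Prod>b\<in>young q. inverse (s_scalar n Ip (nat (content b mod (int n + 1)))))" for q
      by (simp add: w_def label_def content_def)
    then show ?thesis
      using sum_over_fibre[OF P _ m, of g "\<lambda>c. inverse (s_scalar n Ip (nat (c mod (int n + 1))))"]
        s_scalar_edge_weight[OF Ip] that G
      by (simp add: F_def c_root_eq_prod_edge_weight[OF Ip] P_def)
  qed
  have "{p \<in> partitions. wt n Ip p = v} = (\<Union>g\<in>G. F g)"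
  proof (intro equalityI subsetI)
    fix p assume p: "p \<in> {p \<in> partitions. wt n Ip p = v}"
    then obtain g where g: "g \<in> partitions" "coloured P g = coloured P p" "\<forall>b\<in>addable g. content b \<in> P"
      using generated_partition_exists[OF _ finF[unfolded F_def]] by blast
    then have "p \<in> F g" using p by (simp add: F_def)
    moreover from this have "g \<in> G" using g p wtF[of p g] by (simp add: G)
    ultimately show "p \<in> (\<Union>g\<in>G. F g)" by blast
  next
    fix p assume "p \<in> (\<Union>g\<in>G. F g)"
    then obtain g where "g \<in> G" "p \<in> F g" by blast
    then show "p \<in> {p \<in> partitions. wt n Ip p = v}"
      using wtF[of p g] by (simp add: F_def G)
  qed
  moreover have "F g \<inter> F h = {}" if "g \<in> G" "h \<in> G" "g \<noteq> h" for g h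
    using that generated_partition_unique[of g h P] by (auto simp: F_def G)
  moreover have "finite G"
    by (rule finite_subset[OF _ finv[of v]]) (auto simp: G)
  ultimately have "(\<Sum>p | p \<in> partitions \<and> wt n Ip p = v. w p) = (\<Sum>g\<in>G. \<Sum>q\<in>F g. w q)"
    using finF by (simp add: sum.UNION_disjoint)
  also have "\<dots> = of_nat (card G) * c_root n Ip"
    by (simp add: fibre)
  finally have "subst_series n Ip (s_scalar n Ip) (Z_all n) v = of_nat (card G) * c_root n Ip"
    by (simp add: subst_series_Z_all[OF Ip] w_def)
  moreover have "c_root n Ip \<noteq> 0"
    by (simp add: c_root_def Let_def)
  ultimately show "Z_generated n Ip v
      = inverse (c_root n Ip) * subst_series n Ip (s_scalar n Ip) (Z_all n) v"
    by (simp add: Z_generated_def gen_series_def G_def)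
qed

end
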